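(* Let $A\in\mathbb{R}^{m\times n}$, $A\neq 0$, and $C\in\mathbb{R}^{p\times n}$ (the equation $XA=C$ may be inconsistent). Let $X^{(0)}\in\mathbb{R}^{p\times m}$ be arbitrary, $R^{(0)}=C-X^{(0)}A$, and for $k\ge 0$ let $$U^{(k)}=\frac{R^{(k)}(A_{i,:})^T}{\|A_{i,:}\|_2^2},\qquad X^{(k+1)}_{:,i}=X^{(k)}_{:,i}+U^{(k)},\qquad R^{(k+1)}=R^{(k)}-U^{(k)}A_{i,:},$$ (all columns of $X^{(k)}$ other than the $i$th being left unchanged), where at each iteration the row index $i\in\{1,\dots,m\}$ is selected at random with probability $\|A_{i,:}\|_2^2/\|A\|_F^2$. Then, in exact arithmetic, for all $k\ge 0$ $$E\bigl[\|(X^{(k)}-CA^+)A\|_F^2\bigr]\le\left(1-\frac{\sigma_{\min}^2(A)}{\|A\|_F^2}\right)^k\|(X^{(0)}-CA^+)A\|_F^2 ,$$ and $X^*=CA^+$ is a minimizer of $\|XA-C\|_F$ over $X\in\mathbb{R}^{p\times m}$.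
   Context: $A_{i,:}$ denotes the $i$th row of $A$, $X_{:,i}$ the $i$th column of $X$, $A^+$ the Moore-Penrose inverse, $\|\cdot\|_F$ the Frobenius norm, and $\sigma_{\min}(A)$ the smallest nonzero singular value of $A$. The index selections at different iterations are independent; zero rows have probability zero and are never selected. *)

theory Defs
  imports "HOL-Probability.Probability"
begin

text \<open>
  A \<open>p \<times> n\<close> real matrix is \<open>real ^ 'n ^ 'p\<close>. On this type the library's \<^const>\<open>norm\<close> is the
  Frobenius norm:
\<close>

lemma norm_matrix_eq_frobenius:
  fixes A :: "real ^ 'n ^ 'm"
  shows "norm A = sqrt (\<Sum>i\<in>UNIV. \<Sum>j\<in>UNIV. (A $ i $ j)\<^sup>2)"
  by (simp add: norm_vec_def L2_set_def sum_nonneg)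

definition is_moore_penrose :: "real ^ 'n ^ 'm \<Rightarrow> real ^ 'm ^ 'n \<Rightarrow> bool" where
  "is_moore_penrose A P \<longleftrightarrow>
     A ** P ** A = A \<and> P ** A ** P = P \<and>
     transpose (A ** P) = A ** P \<and> transpose (P ** A) = P ** A"

lemma is_moore_penrose_unique:
  assumes P: "is_moore_penrose A P" and Q: "is_moore_penrose A Q"
  shows "P = Q"
proof -
  have AP: "A ** P = A ** Q"
  proof -
    have "A ** P = transpose (A ** Q ** (A ** P))"
      using P Q unfolding is_moore_penrose_def by (metis matrix_mul_assoc)
    also have "\<dots> = transpose (A ** P) ** transpose (A ** Q)"
      by (rule matrix_transpose_mul)
    also have "\<dots> = A ** Q"
      using P Q unfolding is_moore_penrose_def by (metis matrix_mul_assoc)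
    finally show ?thesis .
  qed
  have PA: "P ** A = Q ** A"
  proof -
    have "P ** A = transpose (P ** A ** (Q ** A))"
      using P Q unfolding is_moore_penrose_def by (metis matrix_mul_assoc)
    also have "\<dots> = transpose (Q ** A) ** transpose (P ** A)"
      by (rule matrix_transpose_mul)
    also have "\<dots> = Q ** A"
      using P Q unfolding is_moore_penrose_def by (metis matrix_mul_assoc)
    finally show ?thesis .
  qed
  show ?thesis
    using P Q AP PA unfolding is_moore_penrose_def by (metis matrix_mul_assoc)
qed

definition moore_penrose :: "real ^ 'n ^ 'm \<Rightarrow> real ^ 'm ^ 'n" where
  "moore_penrose A = (THE P. is_moore_penrose A P)"

text \<open>
  Singular values are the square roots of the eigenvalues of \<open>A\<^sup>T A\<close>. Using \<open>A A\<^sup>T\<close> instead could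
  only change whether 0 belongs to the set, which is irrelevant for \<open>sigma_min\<close>.
\<close>

definition singular_values :: "real ^ 'n ^ 'm \<Rightarrow> real set" where
  "singular_values A =
     {s. 0 \<le> s \<and> (\<exists>v. v \<noteq> 0 \<and> (transpose A ** A) *v v = s\<^sup>2 *\<^sub>R v)}"

definition sigma_min :: "real ^ 'n ^ 'm \<Rightarrow> real" where
  "sigma_min A = Min {s \<in> singular_values A. s \<noteq> 0}"

text \<open>
  If row \<open>i\<close> of \<open>A\<close> is zero, then \<open>rk_update A R i = 0\<close> by the convention \<open>inverse 0 = 0\<close>; in the
  randomized method such an index has probability zero.
\<close>

definition rk_update :: "real ^ 'n ^ 'm \<Rightarrow> real ^ 'n ^ 'p \<Rightarrow> 'm \<Rightarrow> real ^ 'p" where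
  "rk_update A R i = (R *v row i A) /\<^sub>R (norm (row i A))\<^sup>2"

definition rk_step ::
  "real ^ 'n ^ 'm \<Rightarrow> 'm \<Rightarrow> (real ^ 'm ^ 'p) \<times> (real ^ 'n ^ 'p) \<Rightarrow> (real ^ 'm ^ 'p) \<times> (real ^ 'n ^ 'p)"
where
  "rk_step A i = (\<lambda>(X, R).
     let U = rk_update A R i
     in ((\<chi> a j. if j = i then X $ a $ j + U $ a else X $ a $ j),
         (\<chi> a j. R $ a $ j - U $ a * row i A $ j)))"

text \<open>
  The pair \<open>(X\<^sup>k, R\<^sup>k)\<close> produced when row \<open>sel l\<close> is used to pass from iterate \<open>l\<close> to iterate
  \<open>l + 1\<close>.
\<close>

primrec rk_state ::
  "real ^ 'n ^ 'm \<Rightarrow> real ^ 'n ^ 'p \<Rightarrow> real ^ 'm ^ 'p \<Rightarrow> (nat \<Rightarrow> 'm) \<Rightarrow> nat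
     \<Rightarrow> (real ^ 'm ^ 'p) \<times> (real ^ 'n ^ 'p)"
where
  "rk_state A C X0 sel 0 = (X0, C - X0 ** A)"
| "rk_state A C X0 sel (Suc k) = rk_step A (sel k) (rk_state A C X0 sel k)"

definition rk_iterate ::
  "real ^ 'n ^ 'm \<Rightarrow> real ^ 'n ^ 'p \<Rightarrow> real ^ 'm ^ 'p \<Rightarrow> (nat \<Rightarrow> 'm) \<Rightarrow> nat \<Rightarrow> real ^ 'm ^ 'p"
where
  "rk_iterate A C X0 sel k = fst (rk_state A C X0 sel k)"

definition row_selection :: "'w measure \<Rightarrow> real ^ 'n ^ 'm \<Rightarrow> (nat \<Rightarrow> 'w \<Rightarrow> 'm) \<Rightarrow> bool" where
  "row_selection M A I \<longleftrightarrow>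
     prob_space M \<and>
     prob_space.indep_vars M (\<lambda>_. count_space UNIV) I UNIV \<and>
     (\<forall>k i. measure M {\<omega> \<in> space M. I k \<omega> = i} = (norm (row i A))\<^sup>2 / (norm A)\<^sup>2)"

text \<open>
  The iterates take finitely many values, so expectations of functions of them are genuine
  (the Bochner integral does not fall back to its default value 0).
\<close>

lemma integrable_rk_iterate:
  fixes A :: "real ^ 'n ^ 'm" and C :: "real ^ 'n ^ 'p" and f :: "real ^ 'm ^ 'p \<Rightarrow> real"
  assumes "row_selection M A I"
  shows "integrable M (\<lambda>\<omega>. f (rk_iterate A C X0 (\<lambda>l. I l \<omega>) k))"
proof -
  interpret prob_space M using assms by (simp add: row_selection_def)
  have meas: "I l \<in> measurable M (count_space UNIV)" for l
    using assms by (simp add: row_selection_def indep_vars_def)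
  have sel: "simple_function M (I l)" for l
    unfolding simple_function_def using measurable_sets[OF meas]
    by (auto intro: finite_subset[OF subset_UNIV] simp: Int_commute)
  have state: "simple_function M (\<lambda>\<omega>. rk_state A C X0 (\<lambda>l. I l \<omega>) k)"
    by (induction k) (auto intro: simple_function_compose2[OF sel])
  have "simple_function M (\<lambda>\<omega>. f (rk_iterate A C X0 (\<lambda>l. I l \<omega>) k))"
    unfolding rk_iterate_def
    using simple_function_compose[OF state, of "\<lambda>s. f (fst s)"] by (simp add: comp_def)
  then show ?thesis
    by (intro integrable_simple_function) (auto simp: emeasure_eq_measure)
qed

end

theory Submission imports Defs begin

text \<open>
  Put \<open>W = (X - C A\<^sup>+) A\<close>. Since \<open>(C A\<^sup>+ A - C) A\<^sup>T = 0\<close>, the inconsistent part of the residual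
  is orthogonal to every row of \<open>A\<close>, so selecting row \<open>a\<close> projects each row of \<open>W\<close> onto the
  orthogonal complement of \<open>a\<close>: the squared error drops by exactly \<open>norm (W a)\<^sup>2 / norm a\<^sup>2\<close>.
  Averaged over the choice of the row, the drop is \<open>norm (W A\<^sup>T)\<^sup>2 / norm A\<^sup>2\<close>, and the rows of \<open>W\<close>
  lie in the row space of \<open>A\<close>, on which \<open>A\<close> stretches by at least \<open>sigma_min A\<close>.
  Independence of the selections turns this into a contraction of the expected error.
\<close>

section \<open>Matrices\<close>

lemma dot_rmul_matrix:
  fixes A :: "real ^ 'n ^ 'm"
  shows "y \<bullet> (x v* A) = (A *v y) \<bullet> x"
  by (metis dot_lmul_matrix inner_commute)

text \<open>The row space is orthogonal to the kernel: \<open>v = transpose A *v z\<close> gives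
  \<open>v \<bullet> v = z \<bullet> (A *v v)\<close>.\<close>

lemma vector_in_row_space_eq_0:
  fixes A :: "real ^ 'n ^ 'm"
  assumes "v \<in> range ((*v) (transpose A))" "A *v v = 0"
  shows "v = 0"
proof -
  obtain z where z: "v = transpose A *v z" using assms(1) by blast
  have "v \<bullet> v = z \<bullet> (A *v v)"
    by (simp add: z dot_lmul_matrix)
  then show ?thesis using assms(2) by simp
qed

lemma subspace_range_matrix:
  fixes A :: "real ^ 'n ^ 'm"
  shows "subspace (range ((*v) A))"
  by (intro linear_subspace_image subspace_UNIV) simp

lemma norm_add_scaleR_square:
  fixes x y :: "'a :: real_inner"
  shows "(norm (x + t *\<^sub>R y))\<^sup>2 = (norm x)\<^sup>2 + 2 * t * (x \<bullet> y) + t\<^sup>2 * (norm y)\<^sup>2"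
  unfolding power2_norm_eq_inner
  by (simp add: inner_add_left inner_add_right inner_commute algebra_simps power2_eq_square)

lemma norm_matrix_rows:
  fixes W :: "real ^ 'n ^ 'm"
  shows "(norm W)\<^sup>2 = (\<Sum>a\<in>UNIV. (norm (W $ a))\<^sup>2)"
  by (simp add: norm_vec_def L2_set_def sum_nonneg)

lemma matrix_matrix_mult_row:
  fixes Y :: "real ^ 'm ^ 'p" and A :: "real ^ 'n ^ 'm"
  shows "(Y ** A) $ a = transpose A *v (Y $ a)"
  by (simp add: vec_eq_iff matrix_matrix_mult_def matrix_vector_mult_def transpose_def mult.commute)

text \<open>Row by row this is the adjointness of \<open>A\<close> and \<open>transpose A\<close>.
  It lets orthogonality to every \<open>Y ** A\<close> be read off from a single matrix
  equation.\<close>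

lemma inner_matrix_mult_left:
  fixes Y :: "real ^ 'm ^ 'p" and A :: "real ^ 'n ^ 'm"
  shows "(Y ** A) \<bullet> Z = Y \<bullet> (Z ** transpose A)"
proof -
  have "(Y ** A) \<bullet> Z = (\<Sum>a\<in>UNIV. (Y ** A) $ a \<bullet> Z $ a)" by (simp add: inner_vec_def)
  also have "\<dots> = (\<Sum>a\<in>UNIV. Y $ a \<bullet> (Z ** transpose A) $ a)"
    by (simp add: matrix_matrix_mult_row dot_lmul_matrix)
  finally show ?thesis by (simp add: inner_vec_def)
qed

lemma matrix_diff_rdistrib:
  fixes A B :: "real ^ 'm ^ 'p" and C :: "real ^ 'n ^ 'm"
  shows "(A - B) ** C = A ** C - B ** C"
  by (simp add: vec_eq_iff matrix_matrix_mult_def left_diff_distrib sum_subtractf)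

section \<open>Existence of the Moore--Penrose inverse\<close>

text \<open>\<open>A\<close> is injective on its row space, so it has a linear left inverse there.
  The equation says that \<open>P ** A\<close> fixes the row space pointwise.\<close>

lemma ex_left_inverse_on_row_space:
  fixes A :: "real ^ 'n ^ 'm"
  obtains P :: "real ^ 'm ^ 'n" where "P ** A ** transpose A = transpose A"
proof -
  let ?V = "range ((*v) (transpose A))"
  have inj: "inj_on ((*v) A) ?V"
  proof (rule inj_onI)
    fix x y assume xy: "x \<in> ?V" "y \<in> ?V" "A *v x = A *v y"
    have "x - y \<in> ?V" using xy(1,2) subspace_range_matrix by (intro subspace_diff)
    moreover have "A *v (x - y) = 0" using xy(3) by (simp add: matrix_vector_mult_diff_distrib)
    ultimately show "x = y" using vector_in_row_space_eq_0 by fastforce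
  qed
  obtain g where g: "linear g" "\<And>v. v \<in> ?V \<Longrightarrow> g (A *v v) = v"
    using real_vector.linear_exists_left_inverse_on[OF _ subspace_range_matrix inj]
    by (auto simp: linear_linear)
  have "(matrix g ** A ** transpose A) *v x = transpose A *v x" for x
    using g by (simp add: matrix_works linear_matrix_vector_mul_eq flip: matrix_vector_mul_assoc)
  then show ?thesis using that by (metis matrix_eq)
qed

lemma ex_symmetric_left_inverse:
  fixes A :: "real ^ 'n ^ 'm"
  obtains P :: "real ^ 'm ^ 'n" where "A ** P ** A = A" "transpose (P ** A) = P ** A"
proof -
  obtain P :: "real ^ 'm ^ 'n" where P: "P ** A ** transpose A = transpose A"
    by (rule ex_left_inverse_on_row_space)
  have "P ** A ** transpose (P ** A) = P ** A ** transpose A ** transpose P"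
    by (simp add: matrix_transpose_mul matrix_mul_assoc)
  also have "\<dots> = transpose (P ** A)" by (simp add: P matrix_transpose_mul)
  finally have PA: "P ** A ** transpose (P ** A) = transpose (P ** A)" .
  \<comment> \<open>The left-hand side of \<open>PA\<close> is symmetric, hence so is the right-hand
    side.\<close>
  then have sym: "transpose (P ** A) = P ** A"
    by (metis matrix_transpose_mul transpose_transpose)
  have "transpose (A ** P ** A) = P ** A ** transpose A"
    by (metis sym matrix_transpose_mul matrix_mul_assoc)
  then have "A ** P ** A = A" by (metis P transpose_transpose)
  then show ?thesis using that sym by blast
qed

text \<open>\<open>P A Q\<close> is the Moore--Penrose inverse whenever \<open>P\<close> and \<open>Q\<close> are generalized inverses with
  \<open>P A\<close> and \<open>A Q\<close> symmetric; such a \<open>Q\<close> comes from \<open>A\<^sup>T\<close> by transposition.\<close>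

lemma is_moore_penrose_moore_penrose:
  fixes A :: "real ^ 'n ^ 'm"
  shows "is_moore_penrose A (moore_penrose A)"
proof -
  obtain P where P: "A ** P ** A = A" "transpose (P ** A) = P ** A"
    by (rule ex_symmetric_left_inverse)
  obtain Q where Q: "transpose A ** Q ** transpose A = transpose A"
      "transpose (Q ** transpose A) = Q ** transpose A"
    by (rule ex_symmetric_left_inverse)
  let ?Q = "transpose Q"
  have Q1: "A ** ?Q ** A = A"
    using arg_cong[OF Q(1), of transpose] by (simp add: matrix_transpose_mul matrix_mul_assoc)
  have Q2: "transpose (A ** ?Q) = A ** ?Q"
    using Q(2) by (simp add: matrix_transpose_mul)
  \<comment> \<open>Multiplying the candidate by \<open>A\<close> on either side collapses it to
    \<open>A ** ?Q\<close> or \<open>P ** A\<close>, both already known to be symmetric.\<close>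
  have L: "A ** (P ** A ** ?Q) = A ** ?Q"
    using P(1) by (simp add: matrix_mul_assoc)
  have R: "(P ** A ** ?Q) ** A = P ** A"
    using Q1 by (metis matrix_mul_assoc)
  have "is_moore_penrose A (P ** A ** ?Q)"
    unfolding is_moore_penrose_def L R
    by (intro conjI Q1 Q2 P(2)) (metis P(1) matrix_mul_assoc)
  then show ?thesis
    unfolding moore_penrose_def by (rule theI) (metis is_moore_penrose_unique \<open>is_moore_penrose A (P ** A ** ?Q)\<close>)
qed

text \<open>Since \<open>moore_penrose A ** A\<close> is symmetric, the left-hand side is the
  transpose of \<open>A ** moore_penrose A ** A\<close>, which is \<open>A\<close>.\<close>

lemma moore_penrose_transpose:
  fixes A :: "real ^ 'n ^ 'm"
  shows "moore_penrose A ** A ** transpose A = transpose A"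
proof -
  have "moore_penrose A ** A ** transpose A = transpose (A ** moore_penrose A ** A)"
    using is_moore_penrose_moore_penrose[of A]
    unfolding is_moore_penrose_def by (metis matrix_transpose_mul matrix_mul_assoc)
  then show ?thesis
    using is_moore_penrose_moore_penrose[of A] by (simp add: is_moore_penrose_def)
qed

text \<open>These are the normal equations. They yield minimality of
  \<open>C ** moore_penrose A\<close> and also remove the inconsistent part of \<open>C\<close> from
  the updates.\<close>

lemma least_squares_residual_orthogonal:
  fixes A :: "real ^ 'n ^ 'm" and C :: "real ^ 'n ^ 'p"
  shows "(C ** moore_penrose A ** A - C) ** transpose A = 0"
proof -
  have "C ** moore_penrose A ** A ** transpose A = C ** (moore_penrose A ** A ** transpose A)"
    by (simp add: matrix_mul_assoc)
  then show ?thesis by (simp only: matrix_diff_rdistrib moore_penrose_transpose diff_self)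
qed

text \<open>Pythagoras: \<open>X ** A - C\<close> splits into \<open>?Y\<close>, which depends on
  \<open>X\<close>, and the fixed residual \<open>?Z\<close>, orthogonal to it.\<close>

lemma moore_penrose_least_squares:
  fixes A :: "real ^ 'n ^ 'm" and C :: "real ^ 'n ^ 'p"
  shows "is_arg_min (\<lambda>X :: real ^ 'm ^ 'p. norm (X ** A - C)) (\<lambda>X. True) (C ** moore_penrose A)"
proof -
  have "norm (C ** moore_penrose A ** A - C) \<le> norm (X ** A - C)" for X :: "real ^ 'm ^ 'p"
  proof -
    let ?Y = "(X - C ** moore_penrose A) ** A" and ?Z = "C ** moore_penrose A ** A - C"
    have "?Y \<bullet> ?Z = 0"
      by (simp add: inner_matrix_mult_left least_squares_residual_orthogonal)
    then have "(norm (?Y + ?Z))\<^sup>2 = (norm ?Y)\<^sup>2 + (norm ?Z)\<^sup>2"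
      by (simp add: power2_norm_eq_inner inner_add_left inner_add_right inner_commute)
    moreover have "?Y + ?Z = X ** A - C" by (simp add: matrix_diff_rdistrib)
    ultimately have "(norm ?Z)\<^sup>2 \<le> (norm (X ** A - C))\<^sup>2" by simp
    then show ?thesis by simp
  qed
  then show ?thesis by (auto simp: is_arg_min_def not_less)
qed

section \<open>The smallest nonzero singular value\<close>

text \<open>Makes the \<open>Min\<close> in \<open>sigma_min\<close> meaningful. Eigenvectors of a
  symmetric matrix for distinct eigenvalues are orthogonal, and a pairwise orthogonal set is
  finite.\<close>

lemma finite_singular_values:
  fixes A :: "real ^ 'n ^ 'm"
  shows "finite (singular_values A)"
proof -
  let ?B = "transpose A ** A"
  have "\<forall>s\<in>singular_values A. \<exists>v. v \<noteq> 0 \<and> ?B *v v = s\<^sup>2 *\<^sub>R v"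
    by (simp add: singular_values_def)
  then obtain e where e: "\<And>s. s \<in> singular_values A \<Longrightarrow> e s \<noteq> 0 \<and> ?B *v e s = s\<^sup>2 *\<^sub>R e s"
    by metis
  have orth: "orthogonal (e s) (e t)"
    if st: "s \<in> singular_values A" "t \<in> singular_values A" "s \<noteq> t" for s t
  proof -
    have "(?B *v e s) \<bullet> e t = e s \<bullet> (?B *v e t)"
      by (simp add: dot_lmul_matrix dot_rmul_matrix
          flip: matrix_vector_mul_assoc)
    then have "s\<^sup>2 * (e s \<bullet> e t) = t\<^sup>2 * (e s \<bullet> e t)" using e st by simp
    \<comment> \<open>Singular values are nonnegative, so distinct ones have distinct
      squares.\<close>
    moreover have "s\<^sup>2 \<noteq> t\<^sup>2"
      using st by (auto simp: singular_values_def)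
    ultimately show ?thesis by (simp add: orthogonal_def)
  qed
  have "inj_on e (singular_values A)"
    using orth e by (metis inj_onI orthogonal_self)
  moreover have "finite (e ` singular_values A)"
    using orth by (intro pairwise_orthogonal_imp_finite) (auto simp: pairwise_def)
  ultimately show ?thesis using finite_imageD by blast
qed

text \<open>The unit vector of the row space at which \<open>norm (A *v v)\<close> is smallest is an eigenvector of
  \<open>A\<^sup>T A\<close>, by the first-order condition.\<close>

lemma ex_singular_value_lower_bound:
  fixes A :: "real ^ 'n ^ 'm"
  assumes "A \<noteq> 0"
  obtains s where "s \<in> singular_values A" "0 < s" "s \<le> norm A"
    "\<And>w. w \<in> range ((*v) (transpose A)) \<Longrightarrow> s * norm w \<le> norm (A *v w)"
proof -
  define V where "V = range ((*v) (transpose A))"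
  let ?K = "V \<inter> sphere 0 1"
  have V: "subspace V" unfolding V_def by (rule subspace_range_matrix)
  have AV: "transpose A *v y \<in> V" for y by (simp add: V_def del: transpose_matrix_vector)
  have "transpose A \<noteq> 0" using assms by (auto simp: vec_eq_iff transpose_def)
  then obtain u where u: "transpose A *v u \<noteq> 0"
    using matrix_eq[of "transpose A" 0] by (auto simp del: transpose_matrix_vector)
  have "(1 / norm (transpose A *v u)) *\<^sub>R (transpose A *v u) \<in> ?K"
    using u AV V by (auto intro!: subspace_scale simp del: transpose_matrix_vector)
  then have "?K \<noteq> {}" by blast
  moreover have "compact ?K"
    using closed_subspace[OF V] by (intro closed_Int_compact) auto
  moreover have "continuous_on ?K (\<lambda>v. norm (A *v v))"
    by (intro continuous_intros linear_continuous_on) simp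
  ultimately obtain v where vK: "v \<in> ?K"
    and least: "\<And>y. y \<in> ?K \<Longrightarrow> norm (A *v v) \<le> norm (A *v y)"
    using continuous_attains_inf[of ?K "\<lambda>v. norm (A *v v)"] by blast
  then have v: "v \<in> V" "norm v = 1" by auto
  define s where "s = norm (A *v v)"
  have bound: "s * norm w \<le> norm (A *v w)" if "w \<in> V" for w
  proof (cases "w = 0")
    case False
    have "(1 / norm w) *\<^sub>R w \<in> ?K" using that V False by (auto intro!: subspace_scale)
    then have "s \<le> norm (A *v ((1 / norm w) *\<^sub>R w))" unfolding s_def by (rule least)
    also have "\<dots> = norm (A *v w) / norm w" by (simp add: matrix_vector_mult_scaleR)
    finally show ?thesis using False by (simp add: field_simps)
  qed simp
  have pos: "0 < s"
    using v vector_in_row_space_eq_0[of v A] by (fastforce simp: s_def V_def)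
  \<comment> \<open>Row-wise Cauchy-Schwarz against the unit vector \<open>v\<close>. This bound
    later makes the contraction factor nonnegative.\<close>
  have le: "s \<le> norm A"
  proof -
    have "(norm (A *v v))\<^sup>2 = (\<Sum>i\<in>UNIV. (A $ i \<bullet> v)\<^sup>2)"
      by (simp add: norm_vec_def L2_set_def sum_nonneg matrix_vector_mul_component)
    also have "\<dots> \<le> (\<Sum>i\<in>UNIV. (norm (A $ i))\<^sup>2)"
    proof (rule sum_mono)
      fix i
      have "\<bar>A $ i \<bullet> v\<bar> \<le> norm (A $ i)" using Cauchy_Schwarz_ineq2[of "A $ i" v] v by simp
      then show "(A $ i \<bullet> v)\<^sup>2 \<le> (norm (A $ i))\<^sup>2" by (metis abs_le_square_iff abs_norm_cancel)
    qed
    finally have "(norm (A *v v))\<^sup>2 \<le> (norm A)\<^sup>2" by (simp only: norm_matrix_rows[of A])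
    then show ?thesis by (simp add: s_def)
  qed
  \<comment> \<open>The defect in the eigenvector equation. It lies in \<open>V\<close>, so
    \<open>v\<close> may be perturbed along it.\<close>
  define z where "z = transpose A *v (A *v v) - s\<^sup>2 *\<^sub>R v"
  have zV: "z \<in> V"
    unfolding z_def using v V AV by (intro subspace_diff subspace_scale)
  define b where "b = (norm (A *v z))\<^sup>2 - s\<^sup>2 * (norm z)\<^sup>2"
  \<comment> \<open>Squaring \<open>bound\<close> at \<open>v + t *\<^sub>R z\<close>, the constant
    terms cancel and the coefficient of \<open>2 * t\<close> is exactly
    \<open>z \<bullet> z\<close>.\<close>
  have quad: "0 \<le> 2 * t * (z \<bullet> z) + t\<^sup>2 * b" for t
  proof -
    have "v + t *\<^sub>R z \<in> V" using v zV V by (intro subspace_add subspace_scale)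
    then have "(s * norm (v + t *\<^sub>R z))\<^sup>2 \<le> (norm (A *v (v + t *\<^sub>R z)))\<^sup>2"
      using bound pos by (intro power_mono) auto
    moreover have "(s * norm (v + t *\<^sub>R z))\<^sup>2 = s\<^sup>2 + 2 * t * (s\<^sup>2 * (v \<bullet> z)) + t\<^sup>2 * (s\<^sup>2 * (norm z)\<^sup>2)"
      using v(2) by (simp add: power_mult_distrib norm_add_scaleR_square algebra_simps)
    moreover have "(norm (A *v (v + t *\<^sub>R z)))\<^sup>2
        = s\<^sup>2 + 2 * t * ((A *v v) \<bullet> (A *v z)) + t\<^sup>2 * (norm (A *v z))\<^sup>2"
      by (simp add: s_def matrix_vector_right_distrib matrix_vector_mult_scaleR norm_add_scaleR_square)
    moreover have "(A *v v) \<bullet> (A *v z) = z \<bullet> z + s\<^sup>2 * (v \<bullet> z)"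
      by (subst (2) z_def) (simp add: inner_diff_left dot_lmul_matrix)
    ultimately show ?thesis by (simp add: b_def algebra_simps)
  qed
  have "z \<bullet> z = 0"
  proof (rule ccontr)
    assume "z \<bullet> z \<noteq> 0"
    then have zz: "0 < z \<bullet> z" by simp
    \<comment> \<open>A negative \<open>t\<close> so small that
      \<open>\<bar>t * b\<bar> \<le> z \<bullet> z\<close>: the linear term wins and the quadratic
      is negative. The \<open>+ 1\<close> covers \<open>b = 0\<close>.\<close>
    define t where "t = - (z \<bullet> z) / (\<bar>b\<bar> + 1)"
    have "t < 0" using zz by (simp add: t_def divide_neg_pos)
    moreover have "2 * (z \<bullet> z) + t * b > 0"
    proof -
      have "\<bar>t * b\<bar> = (z \<bullet> z) * (\<bar>b\<bar> / (\<bar>b\<bar> + 1))" by (simp add: t_def abs_mult)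
      also have "\<dots> \<le> (z \<bullet> z) * 1" using zz by (intro mult_left_mono) auto
      finally show ?thesis using zz by linarith
    qed
    ultimately have "t * (2 * (z \<bullet> z) + t * b) < 0" by (rule mult_neg_pos)
    then show False using quad[of t] by (simp add: algebra_simps power2_eq_square)
  qed
  then have "(transpose A ** A) *v v = s\<^sup>2 *\<^sub>R v"
    by (simp add: z_def flip: matrix_vector_mul_assoc)
  then have "s \<in> singular_values A"
    using v(2) pos unfolding singular_values_def by (intro CollectI conjI exI[of _ v]) auto
  then show ?thesis using that pos le bound unfolding V_def by blast
qed

text \<open>The minimum is attained, hence positive, and is at most the singular value
  \<open>s\<close> found above, so it inherits both bounds of \<open>s\<close>.\<close>

lemma
  fixes A :: "real ^ 'n ^ 'm"
  assumes "A \<noteq> 0"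
  shows sigma_min_pos: "0 < sigma_min A"
    and sigma_min_le_norm: "sigma_min A \<le> norm A"
    and sigma_min_row_space:
      "w \<in> range ((*v) (transpose A)) \<Longrightarrow> sigma_min A * norm w \<le> norm (A *v w)"
proof -
  let ?S = "{s \<in> singular_values A. s \<noteq> 0}"
  obtain s where s: "s \<in> singular_values A" "0 < s" "s \<le> norm A"
    and bound: "\<And>w. w \<in> range ((*v) (transpose A)) \<Longrightarrow> s * norm w \<le> norm (A *v w)"
    using ex_singular_value_lower_bound[OF assms] by metis
  have fin: "finite ?S" by (simp add: finite_singular_values)
  have sS: "s \<in> ?S" using s by simp
  have "sigma_min A \<in> ?S" unfolding sigma_min_def using fin sS by (intro Min_in) auto
  then show "0 < sigma_min A" by (auto simp: singular_values_def)
  have le: "sigma_min A \<le> s" unfolding sigma_min_def using fin sS by (rule Min_le)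
  then show "sigma_min A \<le> norm A" using s by simp
  assume "w \<in> range ((*v) (transpose A))"
  then show "sigma_min A * norm w \<le> norm (A *v w)"
    using bound le by (meson mult_right_mono norm_ge_zero order_trans)
qed

section \<open>One step of the method\<close>

lemma fst_rk_step_mult:
  fixes A :: "real ^ 'n ^ 'm" and X :: "real ^ 'm ^ 'p"
  shows "(fst (rk_step A i (X, R)) ** A) $ a = (X ** A) $ a + (rk_update A R i $ a) *\<^sub>R row i A"
proof -
  define u where "u = rk_update A R i $ a"
  have "(\<Sum>j\<in>UNIV. (if j = i then X $ a $ j + u else X $ a $ j) * A $ j $ b)
      = (\<Sum>j\<in>UNIV. X $ a $ j * A $ j $ b + (if j = i then u * A $ j $ b else 0))" for b
    by (intro sum.cong) (auto simp: distrib_right)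
  also have "\<dots> b = (\<Sum>j\<in>UNIV. X $ a $ j * A $ j $ b) + u * A $ i $ b" for b
    by (simp add: sum.distrib)
  finally show ?thesis
    unfolding u_def by (simp add: vec_eq_iff rk_step_def Let_def matrix_matrix_mult_def row_def)
qed

text \<open>The recursively updated residual stays the true residual, since \<open>R\<close> and
  \<open>C - X ** A\<close> change by the same rank-one term. The state is thus determined by its
  first component.\<close>

lemma rk_state_eq:
  fixes A :: "real ^ 'n ^ 'm" and C :: "real ^ 'n ^ 'p"
  shows "rk_state A C X0 sel k
    = (rk_iterate A C X0 sel k, C - rk_iterate A C X0 sel k ** A)"
proof (induction k)
  case (Suc k)
  let ?X = "rk_iterate A C X0 sel k"
  have "snd (rk_step A i (?X, R)) $ a = R $ a - (rk_update A R i $ a) *\<^sub>R row i A" for i a R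
    by (simp add: vec_eq_iff rk_step_def Let_def)
  then have "snd (rk_step A i (?X, C - ?X ** A)) = C - fst (rk_step A i (?X, C - ?X ** A)) ** A" for i
    by (simp add: vec_eq_iff fst_rk_step_mult)
  moreover have step: "rk_state A C X0 sel (Suc k) = rk_step A (sel k) (?X, C - ?X ** A)"
    by (simp only: rk_state.simps Suc)
  ultimately show ?case
    unfolding rk_iterate_def[of _ _ _ _ "Suc k"] step by (simp add: prod_eq_iff)
qed (simp add: rk_iterate_def)

lemma rk_iterate_Suc:
  fixes A :: "real ^ 'n ^ 'm" and C :: "real ^ 'n ^ 'p"
  shows "rk_iterate A C X0 sel (Suc k)
    = fst (rk_step A (sel k) (rk_iterate A C X0 sel k, C - rk_iterate A C X0 sel k ** A))"
  unfolding rk_iterate_def[of _ _ _ _ "Suc k"] rk_state.simps by (subst rk_state_eq) simp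

lemma rk_iterate_cong:
  fixes A :: "real ^ 'n ^ 'm" and C :: "real ^ 'n ^ 'p"
  assumes "\<And>l. l < k \<Longrightarrow> s l = t l"
  shows "rk_iterate A C X0 s k = rk_iterate A C X0 t k"
proof -
  have "rk_state A C X0 s k = rk_state A C X0 t k"
    using assms by (induction k) auto
  then show ?thesis by (simp add: rk_iterate_def)
qed

text \<open>The residual is the negative of the error term minus \<open>?E\<close>, and
  \<open>?E\<close> annihilates every row of \<open>A\<close>. So the update sees only the error,
  even when \<open>XA = C\<close> is inconsistent.\<close>

lemma residual_mult_row:
  fixes A :: "real ^ 'n ^ 'm" and C :: "real ^ 'n ^ 'p"
  shows "(C - X ** A) *v row i A = - (((X - C ** moore_penrose A) ** A) *v row i A)"
proof -
  let ?E = "C ** moore_penrose A ** A - C"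
  have "(?E *v row i A) $ a = (?E ** transpose A) $ a $ i" for a
    by (simp add: matrix_vector_mult_def matrix_matrix_mult_def row_def transpose_def)
  then have "?E *v row i A = 0"
    by (simp add: vec_eq_iff least_squares_residual_orthogonal)
  then show ?thesis
    by (simp add: matrix_diff_rdistrib matrix_vector_mult_diff_rdistrib)
qed

lemma norm_diff_projection:
  fixes w r :: "'a :: real_inner"
  shows "(norm (w - ((w \<bullet> r) / (norm r)\<^sup>2) *\<^sub>R r))\<^sup>2 = (norm w)\<^sup>2 - (w \<bullet> r)\<^sup>2 / (norm r)\<^sup>2"
\<comment> \<open>For \<open>r = 0\<close> both corrections vanish, because division by zero gives
  0.\<close>
proof (cases "r = 0")
  case False
  then have N: "(norm r)\<^sup>2 \<noteq> 0" by simp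
  have "2 * (- c / N) * c + (- c / N)\<^sup>2 * N = - (c\<^sup>2 / N)" if "N \<noteq> 0" for c N :: real
    using that by (simp add: power2_eq_square)
  from this[OF N, of "w \<bullet> r"] show ?thesis
    using norm_add_scaleR_square[of w "- (w \<bullet> r) / (norm r)\<^sup>2" r] by simp
qed simp

lemma norm_rk_step:
  fixes A :: "real ^ 'n ^ 'm" and C :: "real ^ 'n ^ 'p"
  defines "W \<equiv> \<lambda>X. (X - C ** moore_penrose A) ** A"
  shows "(norm (W (fst (rk_step A i (X, C - X ** A)))))\<^sup>2
    = (norm (W X))\<^sup>2 - (norm (W X *v row i A))\<^sup>2 / (norm (row i A))\<^sup>2"
proof -
  let ?r = "row i A"
  have "W (fst (rk_step A i (X, C - X ** A))) $ a
      = W X $ a - ((W X $ a \<bullet> ?r) / (norm ?r)\<^sup>2) *\<^sub>R ?r" for a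
  proof -
    have "rk_update A (C - X ** A) i = - (W X *v ?r) /\<^sub>R (norm ?r)\<^sup>2"
      by (simp add: rk_update_def residual_mult_row W_def)
    then have "rk_update A (C - X ** A) i $ a = - ((W X $ a \<bullet> ?r) / (norm ?r)\<^sup>2)"
      by (simp add: matrix_vector_mul_component divide_inverse_commute)
    then show ?thesis
      by (simp add: W_def matrix_diff_rdistrib fst_rk_step_mult)
  qed
  then have "(norm (W (fst (rk_step A i (X, C - X ** A)))))\<^sup>2
      = (\<Sum>a\<in>UNIV. (norm (W X $ a))\<^sup>2 - (W X $ a \<bullet> ?r)\<^sup>2 / (norm ?r)\<^sup>2)"
    by (simp add: norm_matrix_rows norm_diff_projection)
  also have "\<dots> = (norm (W X))\<^sup>2 - (norm (W X *v ?r))\<^sup>2 / (norm ?r)\<^sup>2"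
    by (simp add: norm_matrix_rows sum_subtractf sum_divide_distrib norm_vec_def[of "_ *v _"]
        L2_set_def sum_nonneg matrix_vector_mul_component)
  finally show ?thesis .
qed

lemma weighted_norm_rk_step_le:
  fixes A :: "real ^ 'n ^ 'm" and C :: "real ^ 'n ^ 'p"
  assumes "A \<noteq> 0"
  defines "W \<equiv> \<lambda>X. (X - C ** moore_penrose A) ** A"
  shows "(\<Sum>i\<in>UNIV. (norm (row i A))\<^sup>2 / (norm A)\<^sup>2 * (norm (W (fst (rk_step A i (X, C - X ** A)))))\<^sup>2)
    \<le> (1 - (sigma_min A)\<^sup>2 / (norm A)\<^sup>2) * (norm (W X))\<^sup>2"
proof -
  have nA: "(norm A)\<^sup>2 > 0" using assms by simp
  have row: "row i A = A $ i" for i by (simp add: row_def vec_eq_iff)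
  have "(sigma_min A)\<^sup>2 * (norm (W X))\<^sup>2 = (\<Sum>a\<in>UNIV. (sigma_min A * norm (W X $ a))\<^sup>2)"
    by (simp add: norm_matrix_rows sum_distrib_left power_mult_distrib)
  also have "\<dots> \<le> (\<Sum>a\<in>UNIV. (norm (A *v (W X $ a)))\<^sup>2)"
  proof (intro sum_mono power_mono)
    fix a
    have "W X $ a \<in> range ((*v) (transpose A))"
      unfolding W_def matrix_matrix_mult_row by (rule rangeI)
    then show "sigma_min A * norm (W X $ a) \<le> norm (A *v (W X $ a))"
      using sigma_min_row_space[OF assms(1)] by blast
    show "0 \<le> sigma_min A * norm (W X $ a)" using sigma_min_pos[OF assms(1)] by simp
  qed
  also have "\<dots> = (\<Sum>a\<in>UNIV. \<Sum>i\<in>UNIV. (A $ i \<bullet> W X $ a)\<^sup>2)"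
    by (simp add: norm_vec_def[of "_ *v _"] L2_set_def sum_nonneg matrix_vector_mul_component)
  \<comment> \<open>Both sums are the squared Frobenius norm of \<open>W X ** transpose A\<close>,
    taken by rows and by columns.\<close>
  also have "\<dots> = (\<Sum>i\<in>UNIV. (norm (W X *v row i A))\<^sup>2)"
    by (subst sum.swap)
      (simp add: norm_vec_def[of "_ *v _"] L2_set_def sum_nonneg matrix_vector_mul_component row
        inner_commute)
  finally have key: "(sigma_min A)\<^sup>2 * (norm (W X))\<^sup>2 \<le> (\<Sum>i\<in>UNIV. (norm (W X *v row i A))\<^sup>2)" .
  \<comment> \<open>The selection probability cancels the denominator of the drop; for a zero row
    both sides are 0.\<close>
  have term_eq: "(norm (row i A))\<^sup>2 / (norm A)\<^sup>2 * (norm (W (fst (rk_step A i (X, C - X ** A)))))\<^sup>2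
      = ((norm (row i A))\<^sup>2 * (norm (W X))\<^sup>2 - (norm (W X *v row i A))\<^sup>2) / (norm A)\<^sup>2" for i
  proof (cases "row i A = 0")
    case False
    then have r: "(norm (row i A))\<^sup>2 \<noteq> 0" by simp
    have "r / a * (n - b / r) = (r * n - b) / a" if "r \<noteq> 0" for r a n b :: real
      using that by (simp add: right_diff_distrib diff_divide_distrib)
    from this[OF r] show ?thesis unfolding W_def norm_rk_step .
  qed simp
  have "(\<Sum>i\<in>UNIV. (norm (row i A))\<^sup>2 / (norm A)\<^sup>2 * (norm (W (fst (rk_step A i (X, C - X ** A)))))\<^sup>2)
      = ((norm A)\<^sup>2 * (norm (W X))\<^sup>2 - (\<Sum>i\<in>UNIV. (norm (W X *v row i A))\<^sup>2)) / (norm A)\<^sup>2"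
    unfolding term_eq sum_divide_distrib[symmetric] sum_subtractf sum_distrib_right[symmetric]
    by (simp add: row norm_matrix_rows[of A])
  also have "\<dots> \<le> ((norm A)\<^sup>2 * (norm (W X))\<^sup>2 - (sigma_min A)\<^sup>2 * (norm (W X))\<^sup>2) / (norm A)\<^sup>2"
    using key nA by (intro divide_right_mono) auto
  also have "\<dots> = (1 - (sigma_min A)\<^sup>2 / (norm A)\<^sup>2) * (norm (W X))\<^sup>2"
    using nA by (simp add: diff_divide_distrib left_diff_distrib)
  finally show ?thesis .
qed

section \<open>Averaging over the last selection\<close>

text \<open>A finite product of finite discrete spaces is discrete, so every function of finitely
  many selections is measurable.\<close>

lemma sets_PiM_count_space_finite:
  assumes "finite J"
  shows "sets (PiM J (\<lambda>_. count_space (UNIV :: 'm::finite set))) = Pow (PiE J (\<lambda>_. UNIV))"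
proof
  let ?P = "PiM J (\<lambda>_. count_space (UNIV :: 'm set))"
  show "sets ?P \<subseteq> Pow (PiE J (\<lambda>_. UNIV))"
    using sets.sets_into_space[of _ ?P] by (auto simp: space_PiM)
  show "Pow (PiE J (\<lambda>_. UNIV)) \<subseteq> sets ?P"
  proof
    fix X :: "('a \<Rightarrow> 'm) set"
    assume X: "X \<in> Pow (PiE J (\<lambda>_. UNIV))"
    have "finite X"
      using X assms by (auto intro!: finite_subset[OF _ finite_PiE[of J "\<lambda>_. UNIV"]])
    moreover have "{x} \<in> sets ?P" if "x \<in> X" for x
    proof -
      have "PiE J (\<lambda>i. {x i}) = {x}"
        using that X by (intro PiE_singleton) (auto simp: PiE_def)
      then show ?thesis
        using sets_PiM_I_finite[OF assms, of "\<lambda>i. {x i}" "\<lambda>_. count_space (UNIV :: 'm set)"] by simp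
    qed
    ultimately have "(\<Union>x\<in>X. {x}) \<in> sets ?P" by (intro sets.finite_UN)
    then show "X \<in> sets ?P" by simp
  qed
qed

text \<open>By \<open>past\<close>, \<open>g\<close> depends only on the selections before
  \<open>k\<close>, which are independent of \<open>I k\<close>. Splitting by the value of
  \<open>I k\<close> makes each expectation a product.\<close>

lemma (in prob_space) expectation_independent_selection:
  fixes I :: "nat \<Rightarrow> 'a \<Rightarrow> 'm::finite" and g :: "(nat \<Rightarrow> 'm) \<Rightarrow> 'm \<Rightarrow> real"
  assumes ind: "indep_vars (\<lambda>_. count_space UNIV) I UNIV"
    and past: "\<And>s t i. (\<And>l. l < k \<Longrightarrow> s l = t l) \<Longrightarrow> g s i = g t i"
    and int: "\<And>i. integrable M (\<lambda>\<omega>. g (\<lambda>l. I l \<omega>) i)"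
  shows "expectation (\<lambda>\<omega>. g (\<lambda>l. I l \<omega>) (I k \<omega>))
    = (\<Sum>i\<in>UNIV. prob {\<omega> \<in> space M. I k \<omega> = i} * expectation (\<lambda>\<omega>. g (\<lambda>l. I l \<omega>) i))"
proof -
  let ?P = "\<lambda>J. PiM J (\<lambda>_ :: nat. count_space (UNIV :: 'm set))"
  have meas: "f \<in> borel_measurable (?P J)" if "finite J" for J and f :: "(nat \<Rightarrow> 'm) \<Rightarrow> real"
    by (rule measurableI) (auto simp: sets_PiM_count_space_finite[OF that] space_PiM)
  have Ik: "I k \<in> measurable M (count_space UNIV)"
    using ind by (simp add: indep_vars_def)
  \<comment> \<open>Written through \<open>I k \<omega>\<close>, so that \<open>h i\<close> is a
    function of the block \<open>{k}\<close>; \<open>h_eq\<close> recovers the indicator of the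
    event.\<close>
  define h where "h i \<omega> = (indicator {i} (I k \<omega>) :: real)" for i \<omega>
  have ev: "{\<omega> \<in> space M. I k \<omega> = i} \<in> events" for i
    using measurable_sets[OF Ik, of "{i}"] by (simp add: vimage_def Int_def conj_commute)
  have h_eq: "h i \<omega> = indicator {\<omega> \<in> space M. I k \<omega> = i} \<omega>" if "\<omega> \<in> space M" for i \<omega>
    using that by (auto simp: h_def indicator_def)
  have h_int: "integrable M (h i)" for i
    using ev[of i] by (subst Bochner_Integration.integrable_cong[OF refl h_eq])
      (auto simp: emeasure_eq_measure)
  have h_mean: "expectation (h i) = prob {\<omega> \<in> space M. I k \<omega> = i}" for i
    using ev[of i] by (subst Bochner_Integration.integral_cong[OF refl h_eq]) auto
  have indep: "indep_var borel (\<lambda>\<omega>. g (\<lambda>l. I l \<omega>) i) borel (h i)" for i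
  proof -
    have "indep_var borel ((\<lambda>s. g s i) \<circ> (\<lambda>\<omega>. restrict (\<lambda>l. I l \<omega>) {..<k}))
        borel ((\<lambda>s. indicator {i} (s k)) \<circ> (\<lambda>\<omega>. restrict (\<lambda>l. I l \<omega>) {k}))"
      by (rule indep_var_compose[OF indep_var_restrict[OF ind]]) (auto intro: meas)
    \<comment> \<open>Restriction replaces the selections from \<open>k\<close> on by
      \<open>undefined\<close>, which \<open>past\<close> ignores.\<close>
    moreover have "g (restrict (\<lambda>l. I l \<omega>) {..<k}) i = g (\<lambda>l. I l \<omega>) i" for \<omega>
      by (rule past) simp
    ultimately show ?thesis by (simp add: comp_def h_def[abs_def])
  qed
  have "g (\<lambda>l. I l \<omega>) (I k \<omega>) = (\<Sum>i\<in>UNIV. g (\<lambda>l. I l \<omega>) i * h i \<omega>)" for \<omega>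
    by (simp add: h_def indicator_def)
  then have "expectation (\<lambda>\<omega>. g (\<lambda>l. I l \<omega>) (I k \<omega>))
      = (\<Sum>i\<in>UNIV. expectation (\<lambda>\<omega>. g (\<lambda>l. I l \<omega>) i * h i \<omega>))"
    by (simp add: Bochner_Integration.integral_sum indep_var_integrable[OF indep int h_int])
  also have "\<dots> = (\<Sum>i\<in>UNIV. expectation (\<lambda>\<omega>. g (\<lambda>l. I l \<omega>) i) * expectation (h i))"
    by (simp add: indep_var_lebesgue_integral[OF indep int h_int])
  finally show ?thesis by (simp add: h_mean mult.commute)
qed

section \<open>Convergence\<close>

lemma expected_error_bound:
  fixes A :: "real ^ 'n ^ 'm" and C :: "real ^ 'n ^ 'p" and X0 :: "real ^ 'm ^ 'p"
  assumes "A \<noteq> 0" and sel: "row_selection M A I"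
  shows "(\<integral>\<omega>. (norm ((rk_iterate A C X0 (\<lambda>l. I l \<omega>) k - C ** moore_penrose A) ** A))\<^sup>2 \<partial>M)
    \<le> (1 - (sigma_min A)\<^sup>2 / (norm A)\<^sup>2) ^ k * (norm ((X0 - C ** moore_penrose A) ** A))\<^sup>2"
proof -
  interpret prob_space M using sel by (simp add: row_selection_def)
  have ind: "indep_vars (\<lambda>_. count_space UNIV) I UNIV"
    and p: "prob {\<omega> \<in> space M. I k \<omega> = i} = (norm (row i A))\<^sup>2 / (norm A)\<^sup>2" for k i
    using sel by (simp_all add: row_selection_def)
  let ?X = "\<lambda>\<omega> k. rk_iterate A C X0 (\<lambda>l. I l \<omega>) k"
  define err where "err X = (norm ((X - C ** moore_penrose A) ** A))\<^sup>2" for X :: "real ^ 'm ^ 'p"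
  define step where "step X i = fst (rk_step A i (X, C - X ** A))" for X :: "real ^ 'm ^ 'p" and i
  define \<rho> where "\<rho> = 1 - (sigma_min A)\<^sup>2 / (norm A)\<^sup>2"
  note integrable = integrable_rk_iterate[OF sel]
  have "(sigma_min A)\<^sup>2 \<le> (norm A)\<^sup>2"
    using sigma_min_pos sigma_min_le_norm assms(1) by (intro power_mono) (auto simp: less_imp_le)
  then have \<rho>: "0 \<le> \<rho>" using assms(1) by (simp add: \<rho>_def)
  have "expectation (\<lambda>\<omega>. err (?X \<omega> k)) \<le> \<rho> ^ k * err X0"
  proof (induction k)
    case 0
    then show ?case by (simp add: rk_iterate_def prob_space)
  next
    case (Suc k)
    have "expectation (\<lambda>\<omega>. err (?X \<omega> (Suc k))) = expectation (\<lambda>\<omega>. err (step (?X \<omega> k) (I k \<omega>)))"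
      by (simp add: rk_iterate_Suc step_def)
    also have "\<dots> = (\<Sum>i\<in>UNIV. prob {\<omega> \<in> space M. I k \<omega> = i} * expectation (\<lambda>\<omega>. err (step (?X \<omega> k) i)))"
    proof (rule expectation_independent_selection[OF ind, of k "\<lambda>s i. err (step (rk_iterate A C X0 s k) i)"])
      show "err (step (rk_iterate A C X0 s k) i) = err (step (rk_iterate A C X0 t k) i)"
        if "\<And>l. l < k \<Longrightarrow> s l = t l" for s t i
        using rk_iterate_cong[of k s t A C X0] that by simp
    qed (rule integrable)
    \<comment> \<open>The weighted sum returns under the expectation, where the one-step bound
      applies for each \<open>\<omega>\<close>.\<close>
    also have "\<dots> = expectation (\<lambda>\<omega>. \<Sum>i\<in>UNIV. (norm (row i A))\<^sup>2 / (norm A)\<^sup>2 * err (step (?X \<omega> k) i))"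
      by (subst Bochner_Integration.integral_sum, rule integrable) (simp add: p)
    also have "\<dots> \<le> expectation (\<lambda>\<omega>. \<rho> * err (?X \<omega> k))"
      unfolding err_def step_def \<rho>_def
      by (intro integral_mono integrable weighted_norm_rk_step_le[OF assms(1)])
    also have "\<dots> = \<rho> * expectation (\<lambda>\<omega>. err (?X \<omega> k))" by simp
    also have "\<dots> \<le> \<rho> * (\<rho> ^ k * err X0)" using Suc \<rho> by (rule mult_left_mono)
    finally show ?case by simp
  qed
  then show ?thesis by (simp add: err_def \<rho>_def)
qed

theorem theorem3p2:
  fixes A :: "real ^ 'n ^ 'm" and C :: "real ^ 'n ^ 'p" and X0 :: "real ^ 'm ^ 'p"
    and M :: "'w measure" and I :: "nat \<Rightarrow> 'w \<Rightarrow> 'm"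
  assumes "A \<noteq> 0"
    and "row_selection M A I"
  shows "(\<forall>k. (\<integral>\<omega>. (norm ((rk_iterate A C X0 (\<lambda>l. I l \<omega>) k - C ** moore_penrose A) ** A))\<^sup>2 \<partial>M)
              \<le> (1 - (sigma_min A)\<^sup>2 / (norm A)\<^sup>2) ^ k
                 * (norm ((X0 - C ** moore_penrose A) ** A))\<^sup>2)
         \<and> is_arg_min (\<lambda>X :: real ^ 'm ^ 'p. norm (X ** A - C)) (\<lambda>X. True) (C ** moore_penrose A)"
  using expected_error_bound[OF assms] moore_penrose_least_squares by blast

end
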